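(* Let $\breve{\psi}$ be a column vector of $\breve{m}$ observables and suppose that the dictionary $\psi$, of length $m=\breve{m}(d+1)$, is generated by taking $d$ time delays of $\breve{\psi}$: $$\psi=\begin{bmatrix}\breve{\psi}\\ U\circ\breve{\psi}\\ \vdots\\ U^{d}\circ\breve{\psi}\end{bmatrix}.$$ Let $$E=\begin{bmatrix} I_{\breve{m}d}\\ 0\end{bmatrix}\in\mathbb{C}^{m\times\breve{m}d},\qquad E^{\oplus}=\begin{bmatrix}0\\ I_{\breve{m}d}\end{bmatrix}\in\mathbb{C}^{m\times\breve{m}d},$$ where the zero blocks have size $\breve{m}\times\breve{m}d$. Then every IC-DMD model, i.e. every minimizer $$A^*_{\rm IC}\in\arg\min_{A\in\mathcal{A}}\|AX-Y\|_F^2,\qquad \mathcal{A}:=\{A\in\mathbb{C}^{m\times m}: AD=D^{\oplus}\text{ and }E^HA=(E^{\oplus})^H\},$$ has the block Companion structure $$A^*_{\rm IC}=\begin{bmatrix} 0 & I_{\breve{m}} & & \\ & & \ddots & \\ & & & I_{\breve{m}}\\ (\widetilde{A}^*_{\rm IC})_1 & (\widetilde{A}^*_{\rm IC})_2 & \cdots & (\widetilde{A}^*_{\rm IC})_{d+1}\end{bmatrix},$$ that is, partitioning $A^*_{\rm IC}$ into $(d+1)\times(d+1)$ blocks of size $\breve{m}\times\breve{m}$, for $1\le i\le d$ the $(i,i+1)$ block is $I_{\breve{m}}$ and all other blocks of block-row $i$ vanish, while the last block-row consists of sub-matrices $(\widetilde{A}^*_{\rm IC})_1,\dots,(\widetilde{A}^*_{\rm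 IC})_{d+1}\in\mathbb{C}^{\breve{m}\times\breve{m}}$, which define $A^*_{\rm IC}$ (they are the only blocks left to be determined by the minimization).
   Context: Notation: $M^H$ is the conjugate transpose, $I_k$ the $k\times k$ identity, $\|\cdot\|_F$ the Frobenius norm. Setting: $\upsilon^+=\Gamma(\upsilon)$, $\upsilon\in\mathbb{R}^p$, is a discrete-time dynamical system with $\Gamma:\mathbb{R}^p\to\mathbb{R}^p$. Its Koopman operator $U$ acts on complex-valued functions $f$ on $\mathbb{R}^p$ (entrywise on vectors of functions) by $U\circ f:=f\circ\Gamma$. Observables are complex-valued functions on $\mathbb{R}^p$. For sample points $\upsilon_1,\dots,\upsilon_n\in\mathbb{R}^p$, the data matrices are $X=[\psi(\upsilon_j)]_{j=1}^n$ and $Y=[\psi(\Gamma(\upsilon_j))]_{j=1}^n$ in $\mathbb{C}^{m\times n}$. The matrices $D,D^{\oplus}$ encode geometric constraints: for given states $\upsilon^{\rm geom}_1,\dots,\upsilon^{\rm geom}_g\in\mathbb{R}^p$ (possibly none, in which case the constraint $AD=D^{\oplus}$ is vacuous), $D=[\psi(\upsilon^{\rm geom}_i)]_{i=1}^g$ and $D^{\oplus}=[\psi(\Gamma(\upsilon^{\rm geom}_i))]_{i=1}^g$ in $\mathbb{C}^{m\times g}$. *)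

theory Defs
  imports
    "HOL-Analysis.Finite_Cartesian_Product"
    "Jordan_Normal_Form.Schur_Decomposition"
begin

unbundle no vec_syntax

text \<open>States live in \<open>real ^ 'p\<close> (so p is \<open>CARD('p)\<close>); all other vectors and matrices are the
  dimension-carrying ones of \<open>Jordan_Normal_Form\<close>. A column vector of observables is a
  \<open>Matrix.vec\<close> whose entries are functions on the state space.\<close>

type_synonym 'p state = "real ^ 'p"
type_synonym 'p observables = "('p state \<Rightarrow> complex) Matrix.vec"

definition koopman :: "('p::finite state \<Rightarrow> 'p state) \<Rightarrow> 'p observables \<Rightarrow> 'p observables" where
  "koopman \<Gamma> \<psi> = map_vec (\<lambda>f. f \<circ> \<Gamma>) \<psi>"

primrec time_delays ::
  "('p::finite state \<Rightarrow> 'p state) \<Rightarrow> 'p observables \<Rightarrow> nat \<Rightarrow> 'p observables" where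
  "time_delays \<Gamma> \<psi> 0 = \<psi>"
| "time_delays \<Gamma> \<psi> (Suc d) = time_delays \<Gamma> \<psi> d @\<^sub>v (koopman \<Gamma> ^^ Suc d) \<psi>"

definition observe :: "'p::finite observables \<Rightarrow> 'p state \<Rightarrow> complex Matrix.vec" where
  "observe \<psi> x = map_vec (\<lambda>f. f x) \<psi>"

definition data_matrix :: "'p::finite observables \<Rightarrow> 'p state list \<Rightarrow> complex Matrix.mat" where
  "data_matrix \<psi> xs = mat_of_cols (dim_vec \<psi>) (map (observe \<psi>) xs)"

definition frobenius_norm :: "complex Matrix.mat \<Rightarrow> real" where
  "frobenius_norm M = sqrt (\<Sum>i<dim_row M. \<Sum>j<dim_col M. (cmod (M $$ (i, j)))\<^sup>2)"

text \<open>Block indices \<open>i\<close>, \<open>j\<close> start at 1, whereas matrix entries are indexed from 0.\<close>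

definition block :: "nat \<Rightarrow> complex Matrix.mat \<Rightarrow> nat \<Rightarrow> nat \<Rightarrow> complex Matrix.mat" where
  "block b M i j = Matrix.mat b b (\<lambda>(r, c). M $$ ((i - 1) * b + r, (j - 1) * b + c))"

definition block_companion ::
  "nat \<Rightarrow> nat \<Rightarrow> (nat \<Rightarrow> complex Matrix.mat) \<Rightarrow> complex Matrix.mat" where
  "block_companion b d B =
    Matrix.mat (b * (d + 1)) (b * (d + 1)) (\<lambda>(r, c).
      let i = r div b + 1; j = c div b + 1
      in (if i = d + 1 then B j else if j = i + 1 then 1\<^sub>m b else 0\<^sub>m b b) $$ (r mod b, c mod b))"

end

theory Submission
  imports Defs
begin

text \<open>The constraint \<open>E\<^sup>H A = (E\<^sup>\<oplus>)\<^sup>H\<close> fixes the first \<open>m0 * d\<close> rows of \<open>A\<close> to those of a block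
  companion matrix and leaves the last \<open>m0\<close> rows free. Hence the feasible set is the image under
  \<open>block_companion m0 d\<close> of the tuples of \<open>m0 \<times> m0\<close> blocks subject to the geometric constraint, and
  minimizers over an image are the images of the minimizers of the composed objective.\<close>

text \<open>Only values of \<open>f\<close> are compared, and these range over the same set on both
  sides, so \<open>g\<close> may identify points. This matters because
  \<open>block_companion\<close> ignores \<open>B j\<close> for \<open>j\<close> outside
  \<open>{1..d + 1}\<close>.\<close>

lemma is_arg_min_image_iff:
  "is_arg_min f (\<lambda>x. x \<in> g ` S) a \<longleftrightarrow> (\<exists>b. is_arg_min (\<lambda>b. f (g b)) (\<lambda>b. b \<in> S) b \<and> a = g b)"
  unfolding is_arg_min_def by auto

text \<open>Column \<open>r\<close> of the stacked matrix is the \<open>r\<close>-th unit vector, so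
  multiplying by the adjoint selects the first \<open>n\<close> rows.\<close>

lemma mat_adjoint_append_zero_mult_index:
  assumes "A \<in> carrier_mat (n + k) l" "r < n" "c < l"
  shows "(mat_adjoint (1\<^sub>m n @\<^sub>r 0\<^sub>m k n) * A :: complex Matrix.mat) $$ (r, c) = A $$ (r, c)"
proof -
  have carr: "(1\<^sub>m n @\<^sub>r 0\<^sub>m k n :: complex Matrix.mat) \<in> carrier_mat (n + k) n"
    by (intro carrier_append_rows) auto
  have entry: "(1\<^sub>m n @\<^sub>r 0\<^sub>m k n :: complex Matrix.mat) $$ (i, r) = (if i = r then 1 else 0)"
    if "i < n + k" for i
    using that assms(2) by (auto simp: append_rows_def)
  have "(mat_adjoint (1\<^sub>m n @\<^sub>r 0\<^sub>m k n) * A) $$ (r, c)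
      = (\<Sum>i<n + k. cnj ((1\<^sub>m n @\<^sub>r 0\<^sub>m k n) $$ (i, r)) * A $$ (i, c))"
    using assms carrier_matD[OF carr]
    by (simp add: mat_adjoint_def mat_of_rows_def scalar_prod_def atLeast0LessThan)
  also have "\<dots> = (\<Sum>i<n + k. (if i = r then A $$ (i, c) else 0))"
    by (intro sum.cong refl) (simp add: entry)
  also have "\<dots> = A $$ (r, c)"
    using assms by simp
  finally show ?thesis .
qed

lemma mat_adjoint_zero_append_index:
  assumes "r < n" "c < k + n"
  shows "(mat_adjoint (0\<^sub>m k n @\<^sub>r 1\<^sub>m n) :: complex Matrix.mat) $$ (r, c) = (if c = r + k then 1 else 0)"
  using assms by (auto simp: mat_adjoint_def append_rows_def mat_of_rows_def)

text \<open>The constraint is kept entrywise, as ones on the diagonal \<open>c = r + k\<close>;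
  blocks enter only when \<open>k\<close> is taken to be the block size.\<close>

lemma mat_adjoint_shift_iff:
  assumes "A \<in> carrier_mat (n + k) (n + k)"
  shows "mat_adjoint (1\<^sub>m n @\<^sub>r 0\<^sub>m k n) * A = mat_adjoint (0\<^sub>m k n @\<^sub>r 1\<^sub>m n) \<longleftrightarrow>
    (\<forall>r<n. \<forall>c<n + k. A $$ (r, c) = (if c = r + k then 1 else (0 :: complex)))"
    (is "?L = ?R \<longleftrightarrow> _")
proof -
  have dims: "dim_row ?L = n" "dim_col ?L = n + k" "dim_row ?R = n" "dim_col ?R = n + k"
    using assms by (auto simp: mat_adjoint_def append_rows_def mat_of_rows_def)
  have "?L = ?R \<longleftrightarrow> (\<forall>r<n. \<forall>c<n + k. ?L $$ (r, c) = ?R $$ (r, c))"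
    unfolding mat_eq_iff dims by simp
  also have "\<dots> \<longleftrightarrow> (\<forall>r<n. \<forall>c<n + k. A $$ (r, c) = (if c = r + k then 1 else 0))"
    using assms
    by (simp add: mat_adjoint_append_zero_mult_index[OF assms] mat_adjoint_zero_append_index add.commute)
  finally show ?thesis .
qed

lemma block_companion_carrier:
  "block_companion b d B \<in> carrier_mat (b * (d + 1)) (b * (d + 1))"
  by (simp add: block_companion_def)

lemma block_companion_cong:
  assumes "\<And>j. j \<in> {1..d + 1} \<Longrightarrow> B j = B' j"
  shows "block_companion b d B = block_companion b d B'"
proof (rule eq_matI, goal_cases)
  case (1 r c)
  then have "c div b + 1 \<in> {1..d + 1}"
    by (auto simp: block_companion_def less_mult_imp_div_less mult.commute less_Suc_eq_le[symmetric])
  with 1 assms show ?case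
    by (simp add: block_companion_def Let_def)
qed (simp_all add: block_companion_def)

lemma block_companion_index_upper:
  assumes "r < b * d" "c < b * (d + 1)"
  shows "block_companion b d B $$ (r, c) = (if c = r + b then 1 else 0)"
proof -
  have b: "b > 0" and r: "r div b < d" "r < b * (d + 1)"
    using assms by (auto simp: less_mult_imp_div_less mult.commute intro: Nat.gr0I)
  \<comment> \<open>For \<open>b > 0\<close>, adding \<open>b\<close> raises the quotient by one and
    keeps the remainder. Hence the identity blocks on the block superdiagonal together form a single
    diagonal of ones.\<close>
  have "c = r + b \<longleftrightarrow> c div b = r div b + 1 \<and> c mod b = r mod b"
  proof
    assume "c div b = r div b + 1 \<and> c mod b = r mod b"
    then have "b * (c div b) + c mod b = b * (r div b) + r mod b + b" by simp
    then show "c = r + b" by simp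
  qed (use b in simp)
  with b r assms show ?thesis
    by (auto simp: block_companion_def Let_def)
qed

lemma block_block_companion_last:
  assumes "B j \<in> carrier_mat b b" "j \<in> {1..d + 1}"
  shows "block b (block_companion b d B) (d + 1) j = B j"
proof (rule eq_matI, goal_cases)
  case (1 r c)
  then have rc: "r < b" "c < b" using assms by auto
  \<comment> \<open>Keeps block column \<open>j\<close> inside the matrix, where entries are given
    by the defining function; \<open>j - 1\<close> is not truncated since \<open>j\<close> is at
    least 1.\<close>
  have "(j - 1) * b + b \<le> b * (d + 1)"
    using assms mult_le_mono1[of j "d + 1" b]
    by (cases j) (auto simp: algebra_simps)
  then have "(j - 1) * b + c < b * (d + 1)" using rc by linarith
  moreover have "d * b + r < b * (d + 1)" using rc by (simp add: algebra_simps)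
  ultimately show ?case
    using rc assms by (auto simp: block_def block_companion_def Let_def)
qed (use assms in \<open>auto simp: block_def\<close>)

text \<open>With the upper rows forced, the last block-row carries all remaining information, so
  reading it off yields a preimage of \<open>A\<close>.\<close>

lemma block_companion_of_blocks:
  assumes A: "A \<in> carrier_mat (b * (d + 1)) (b * (d + 1))"
    and upper: "\<And>r c. r < b * d \<Longrightarrow> c < b * (d + 1) \<Longrightarrow> A $$ (r, c) = (if c = r + b then 1 else 0)"
  shows "block_companion b d (\<lambda>j. block b A (d + 1) j) = A"
proof (rule eq_matI, goal_cases)
  case (1 r c)
  then have rc: "r < b * (d + 1)" "c < b * (d + 1)" using A by auto
  show ?case
  proof (cases "r < b * d")
    case True
    then show ?thesis using rc by (simp add: block_companion_index_upper upper)
  next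
    case False
    have b: "b > 0" using rc by (auto intro: Nat.gr0I)
    \<comment> \<open>The rows from \<open>b * d\<close> on have zero-based block index
      \<open>d\<close>, which is the case \<open>i = d + 1\<close> of
      \<open>block_companion\<close>.\<close>
    have "r div b = d"
      using False rc b by (intro div_nat_eqI) (auto simp: algebra_simps)
    moreover from this have "d * b + r mod b = r"
      by (metis div_mult_mod_eq)
    ultimately show ?thesis
      using rc b by (simp add: block_companion_def block_def Let_def)
  qed
qed (use A in \<open>auto simp: block_companion_def\<close>)

lemma block_block_companion_upper:
  assumes "i \<in> {1..d}" "j \<in> {1..d + 1}"
  shows "block b (block_companion b d B) i j = (if j = i + 1 then 1\<^sub>m b else 0\<^sub>m b b)"
proof (rule eq_matI, goal_cases)
  case (1 r c)
  then have rc: "r < b" "c < b" by (auto split: if_splits)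
  have "i * b \<le> d * b" "j * b \<le> d * b + b"
    using assms mult_le_mono1[of i d b] mult_le_mono1[of j "d + 1" b] by auto
  moreover have "(i - 1) * b + b = i * b" "(j - 1) * b + b = j * b"
    using assms by (cases i; cases j; simp)+
  moreover have "b * (d + 1) = d * b + b" by simp
  ultimately have "(i - 1) * b + r < b * (d + 1) \<and> (j - 1) * b + c < b * (d + 1)"
    using rc by linarith
  then show ?case
    using rc assms by (auto simp: block_def block_companion_def Let_def)
qed (auto simp: block_def)

lemma shift_constraint_eq_range:
  "{A \<in> carrier_mat (b * (d + 1)) (b * (d + 1)).
      mat_adjoint (1\<^sub>m (b * d) @\<^sub>r 0\<^sub>m b (b * d)) * A = mat_adjoint (0\<^sub>m b (b * d) @\<^sub>r 1\<^sub>m (b * d))}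
    = block_companion b d ` {B. \<forall>j\<in>{1..d + 1}. B j \<in> carrier_mat b b}" (is "?F = _ ` ?S")
proof -
  \<comment> \<open>Taking \<open>n = b * d\<close> and \<open>k = b\<close> turns the matrix
    equation into a condition on the upper rows, the form used in both inclusions.\<close>
  have F: "?F = {A \<in> carrier_mat (b * (d + 1)) (b * (d + 1)).
      \<forall>r<b * d. \<forall>c<b * (d + 1). A $$ (r, c) = (if c = r + b then 1 else 0)}"
    using mat_adjoint_shift_iff[of _ "b * d" b] by (auto simp: add.commute)
  show ?thesis
  proof (intro equalityI subsetI)
    fix A assume "A \<in> ?F"
    then have "A = block_companion b d (\<lambda>j. block b A (d + 1) j)"
      unfolding F by (intro block_companion_of_blocks[symmetric]) auto
    moreover have "(\<lambda>j. block b A (d + 1) j) \<in> ?S" by (simp add: block_def)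
    ultimately show "A \<in> block_companion b d ` ?S" by (rule image_eqI)
  next
    fix A assume "A \<in> block_companion b d ` ?S"
    then obtain B where A: "A = block_companion b d B" by auto
    show "A \<in> ?F" unfolding F A
      by (intro CollectI conjI allI impI block_companion_carrier block_companion_index_upper)
  qed
qed

theorem proposition6p3:
  fixes \<Gamma> :: "real ^ 'p::finite \<Rightarrow> real ^ 'p"
    and \<psi>0 \<psi> :: "(real ^ 'p \<Rightarrow> complex) Matrix.vec"
    and m0 d m :: nat
    and samples geom :: "(real ^ 'p) list"
    and X Y D D_plus E E_plus :: "complex Matrix.mat"
    and \<A> :: "complex Matrix.mat set"
  assumes "\<psi>0 \<in> carrier_vec m0"
    and "m = m0 * (d + 1)"
    and "\<psi> = time_delays \<Gamma> \<psi>0 d"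
    and "X = data_matrix \<psi> samples"
    and "Y = data_matrix \<psi> (map \<Gamma> samples)"
    and "D = data_matrix \<psi> geom"
    and "D_plus = data_matrix \<psi> (map \<Gamma> geom)"
    and "E = 1\<^sub>m (m0 * d) @\<^sub>r 0\<^sub>m m0 (m0 * d)"
    and "E_plus = 0\<^sub>m m0 (m0 * d) @\<^sub>r 1\<^sub>m (m0 * d)"
    and "\<A> = {A \<in> carrier_mat m m. A * D = D_plus \<and> mat_adjoint E * A = mat_adjoint E_plus}"
  shows "(\<forall>A. is_arg_min (\<lambda>A. (frobenius_norm (A * X - Y))\<^sup>2) (\<lambda>A. A \<in> \<A>) A \<longrightarrow>
      A = block_companion m0 d (\<lambda>j. block m0 A (d + 1) j) \<and>
      (\<forall>i\<in>{1..d}. \<forall>j\<in>{1..d+1}.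
        block m0 A i j = (if j = i + 1 then 1\<^sub>m m0 else 0\<^sub>m m0 m0))) \<and>
    (\<forall>A. is_arg_min (\<lambda>A. (frobenius_norm (A * X - Y))\<^sup>2) (\<lambda>A. A \<in> \<A>) A \<longleftrightarrow>
      (\<exists>B. is_arg_min
             (\<lambda>B. (frobenius_norm (block_companion m0 d B * X - Y))\<^sup>2)
             (\<lambda>B. (\<forall>j\<in>{1..d+1}. B j \<in> carrier_mat m0 m0) \<and> block_companion m0 d B * D = D_plus)
             B
           \<and> A = block_companion m0 d B))"
proof -
  define S where "S = {B. (\<forall>j\<in>{1..d + 1}. B j \<in> carrier_mat m0 m0) \<and> block_companion m0 d B * D = D_plus}"
  \<comment> \<open>The geometric constraint is a condition on the matrix alone, so intersecting the
    image with it amounts to restricting the tuples to \<open>S\<close>.\<close>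
  have "\<A> = {A \<in> carrier_mat m m. mat_adjoint E * A = mat_adjoint E_plus} \<inter> {A. A * D = D_plus}"
    using assms(10) by auto
  also have "\<dots> = block_companion m0 d ` S"
    unfolding assms(2,8,9) shift_constraint_eq_range S_def by auto
  finally have \<A>: "\<A> = block_companion m0 d ` S" .
  show ?thesis
  proof (intro conjI allI impI)
    fix A assume "is_arg_min (\<lambda>A. (frobenius_norm (A * X - Y))\<^sup>2) (\<lambda>A. A \<in> \<A>) A"
    then obtain B where B: "B \<in> S" and A: "A = block_companion m0 d B"
      unfolding \<A> is_arg_min_def by auto
    \<comment> \<open>The blocks read off from \<open>A\<close> agree with \<open>B\<close> on
      \<open>{1..d + 1}\<close> but possibly not elsewhere, hence the congruence rule.\<close>
    show "A = block_companion m0 d (\<lambda>j. block m0 A (d + 1) j)"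
      unfolding A using B
      by (intro block_companion_cong block_block_companion_last[symmetric]) (auto simp: S_def)
    show "\<forall>i\<in>{1..d}. \<forall>j\<in>{1..d+1}. block m0 A i j = (if j = i + 1 then 1\<^sub>m m0 else 0\<^sub>m m0 m0)"
      unfolding A by (intro ballI block_block_companion_upper)
  \<comment> \<open>The remaining goal is the equivalence of the two minimization problems;
    rewriting with the image rule makes its sides identical.\<close>
  qed (unfold \<A> is_arg_min_image_iff S_def mem_Collect_eq, rule refl)
qed

end
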